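(* Let $\gamma>0$ be fixed, and for a distribution $F$ let $G$ be the distribution with tail $\overline G(x)=1$ for $x<0$ and $\overline G(x)=\overline F(x)e^{-\gamma x}$ for $x\ge0$. If $F$ belongs to the class $(\mathcal{J}_f\cap\mathcal{K})\setminus\mathcal{OS}^*$, then $G\notin\mathcal{J}$. Further, the class $(\mathcal{J}_f\cap\mathcal{K})\setminus\mathcal{OS}^*$ is not empty.
   Context: All distributions are probability distributions $F$ with unbounded support contained in $[0,\infty)$; $\overline F:=1-F$ is the tail. All limits are as $x\to\infty$ unless indicated. Class $\mathcal{J}$: $F\in\mathcal{J}$ iff, for i.i.d. $X_1,X_2,\dots$ with distribution $F$, $S_n=\sum_{i=1}^n X_i$ and $X_{n,1}=\max_{1\le i\le n}X_i$, one has for all $n\ge2$ (equivalently, for $n=2$) $\lim_{K\to\infty}\liminf_{x\to\infty}\mathbb{P}(X_{n,1}>x-K\mid S_n>x)=1$. $\mathcal{J}_f$ is the class of distributions in $\mathcal{J}$ with finite mean. Class $\mathcal{K}$ (heavy-tailed): $\int_0^\infty e^{\lambda y}F(dy)=\infty$ for all $\lambda>0$. Class $\mathcal{OS}^*$: $F$ has finite mean $\mu>0$ and $\limsup_{x\to\infty}\frac{1}{\overline F(x)}\int_0^x\overline F(x-y)\overline F(y)\,dy<\infty$. *)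

theory Defs
  imports "HOL-Probability.Probability"
begin

definition tail :: "real measure \<Rightarrow> real \<Rightarrow> real" where
  "tail F x = 1 - cdf F x"

(* For a probability measure F on the reals, the support of F is contained in [0,\<infinity>) iff F gives
   no mass to the negative reals, and it is then unbounded iff no tail vanishes. *)
definition unbounded_nonneg_distribution :: "real measure \<Rightarrow> bool" where
  "unbounded_nonneg_distribution F \<longleftrightarrow>
     real_distribution F \<and> measure F {..<0} = 0 \<and> (\<forall>x. tail F x > 0)"

(* The i.i.d. variables X_1, ..., X_n are realized as the coordinates of the n-fold product of F. *)
definition class_J :: "real measure set" where
  "class_J = {F. unbounded_nonneg_distribution F \<and>
     (\<forall>n\<ge>2.
        ((\<lambda>K::real. Liminf at_top (\<lambda>x::real. ereal
            (\<P>(X in (\<Pi>\<^sub>M i\<in>{1..n::nat}. F).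
                (MAX i\<in>{1..n}. X i) > x - K \<bar> (\<Sum>i\<in>{1..n}. X i) > x))))
          \<longlongrightarrow> 1) at_top)}"

definition class_Jf :: "real measure set" where
  "class_Jf = {F \<in> class_J. integrable F (\<lambda>y. y)}"

definition class_K :: "real measure set" where
  "class_K = {F. unbounded_nonneg_distribution F \<and>
     (\<forall>l>0. (\<integral>\<^sup>+y\<in>{0..}. ennreal (exp (l * y)) \<partial>F) = \<infinity>)}"

definition class_OS_star :: "real measure set" where
  "class_OS_star = {F. unbounded_nonneg_distribution F \<and>
     integrable F (\<lambda>y. y) \<and> (\<integral>y. y \<partial>F) > 0 \<and>
     Limsup at_top (\<lambda>x. ereal (1 / tail F x * (LBINT y:{0..x}. tail F (x - y) * tail F y))) < \<infinity>}"

(* The distribution whose tail is 1 on the negative reals and tail F x * exp (- \<gamma> x) for x \<ge> 0,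
   given by its distribution function; see tail_exp_tilt. *)
definition exp_tilt :: "real \<Rightarrow> real measure \<Rightarrow> real measure" where
  "exp_tilt \<gamma> F = interval_measure (\<lambda>x. if x < 0 then 0 else 1 - tail F x * exp (- \<gamma> * x))"

context
  fixes \<gamma> :: real and F :: "real measure"
  assumes gamma_pos: "\<gamma> > 0" and F: "unbounded_nonneg_distribution F"
begin

private definition H :: "real \<Rightarrow> real" where
  "H x = (if x < 0 then 0 else 1 - tail F x * exp (- \<gamma> * x))"

interpretation F: real_distribution F
  using F by (simp add: unbounded_nonneg_distribution_def)

private lemma tail_bounds: "0 \<le> tail F x" "tail F x \<le> 1"
  by (auto simp: tail_def F.cdf_bounded_prob F.cdf_nonneg)

private lemma H_mono: "x \<le> y \<Longrightarrow> H x \<le> H y"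
proof -
  assume xy: "x \<le> y"
  have a: "tail F y * exp (- \<gamma> * y) \<le> tail F x * exp (- \<gamma> * x)"
    using xy gamma_pos tail_bounds
    by (intro mult_mono) (auto simp: tail_def F.cdf_nondecreasing)
  have b: "tail F y * exp (- \<gamma> * y) \<le> 1" if "y \<ge> 0"
    using that gamma_pos tail_bounds by (intro mult_le_one) auto
  show ?thesis using xy a b by (auto simp: H_def)
qed

private lemma H_right_cont: "continuous (at_right a) H"
proof (cases "a < 0")
  case True
  have "\<forall>\<^sub>F x in at_right a. x < 0"
    using True by (auto simp: eventually_at_right[of a 0])
  then have "(H \<longlongrightarrow> 0) (at_right a)"
    by (intro tendsto_eventually) (auto elim: eventually_mono simp: H_def)
  then show ?thesis using True by (simp add: continuous_within H_def)
next
  case False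
  have "((\<lambda>x. 1 - tail F x * exp (- \<gamma> * x)) \<longlongrightarrow> 1 - tail F a * exp (- \<gamma> * a)) (at_right a)"
    unfolding tail_def
    by (intro tendsto_intros F.cdf_is_right_cont[unfolded continuous_within])
  then have "(H \<longlongrightarrow> 1 - tail F a * exp (- \<gamma> * a)) (at_right a)"
    by (rule Lim_transform_eventually)
       (use False in \<open>auto simp: H_def eventually_at_filter\<close>)
  then show ?thesis using False by (simp add: continuous_within H_def)
qed

private lemma H_at_bot: "(H \<longlongrightarrow> 0) at_bot"
  by (intro tendsto_eventually) (use eventually_gt_at_bot eventually_at_bot_dense in
    \<open>auto simp: H_def eventually_at_bot_dense\<close>)

private lemma H_at_top: "(H \<longlongrightarrow> 1) at_top"
proof -
  have "((\<lambda>x. 1 - tail F x * exp (- \<gamma> * x)) \<longlongrightarrow> 1 - (1 - 1) * 0) at_top"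
    unfolding tail_def
  proof (intro tendsto_intros F.cdf_lim_at_top_prob)
    show "((\<lambda>x. exp (- \<gamma> * x)) \<longlongrightarrow> 0) at_top"
    proof (rule filterlim_compose[OF exp_at_bot])
      have "filterlim (\<lambda>x. \<gamma> * x) at_top at_top"
        by (rule filterlim_tendsto_pos_mult_at_top[OF tendsto_const gamma_pos filterlim_ident])
      then show "filterlim (\<lambda>x. - \<gamma> * x) at_bot at_top"
        by (simp add: filterlim_uminus_at_top)
    qed
  qed
  then have "(H \<longlongrightarrow> 1 - (1 - 1) * 0) at_top"
    by (rule Lim_transform_eventually)
       (auto simp: H_def intro: eventually_mono[OF eventually_ge_at_top[of 0]])
  then show ?thesis by simp
qed

private lemma exp_tilt_H: "exp_tilt \<gamma> F = interval_measure H"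
  by (simp add: exp_tilt_def H_def[abs_def])

private lemma cdf_exp_tilt: "cdf (exp_tilt \<gamma> F) = H"
  unfolding exp_tilt_H by (rule cdf_interval_measure[OF H_mono H_right_cont H_at_bot])

lemma tail_exp_tilt:
  "tail (exp_tilt \<gamma> F) x = (if x < 0 then 1 else tail F x * exp (- \<gamma> * x))"
  by (simp add: tail_def cdf_exp_tilt) (simp add: H_def tail_def)

lemma unbounded_nonneg_distribution_exp_tilt:
  "unbounded_nonneg_distribution (exp_tilt \<gamma> F)"
  unfolding unbounded_nonneg_distribution_def
proof (intro conjI allI)
  show rd: "real_distribution (exp_tilt \<gamma> F)"
    unfolding exp_tilt_H
    by (rule real_distribution_interval_measure[OF H_mono H_right_cont H_at_bot H_at_top])
  interpret G: real_distribution "exp_tilt \<gamma> F" by (rule rd)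
  have "(cdf (exp_tilt \<gamma> F) \<longlongrightarrow> 0) (at_left 0)"
    by (intro tendsto_eventually) (auto simp: cdf_exp_tilt H_def eventually_at_filter)
  then show "measure (exp_tilt \<gamma> F) {..<0} = 0"
    using G.cdf_at_left[of 0] tendsto_unique[OF trivial_limit_at_left_real] by blast
  show "tail (exp_tilt \<gamma> F) x > 0" for x
    using F by (simp add: tail_exp_tilt unbounded_nonneg_distribution_def)
qed

end

end

theory Submission
  imports Defs
begin

text \<open>If \<open>G \<in> J\<close>, then \<open>P(S\<^sub>2 > x) \<le> 4 P(X\<^sub>1 > x - K)\<close> for some \<open>K\<close> and all large \<open>x\<close>. Since a sum of two
  exceeds \<open>x\<close> whenever one summand exceeds \<open>x - 2K\<close> and the other \<open>2K\<close>, this makes the tail of \<open>G\<close>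
  insensitive to bounded shifts up to a constant factor, and \<open>P(S\<^sub>2 > x)\<close> is at most a multiple of
  the tail of \<open>G\<close> at \<open>x\<close>. On the other hand, \<open>G\<close> is the law of the minimum of a variable
  with law \<open>F\<close> and an independent exponential one, so it dominates the measure with density
  \<open>\<gamma> exp (- \<gamma> y) tail F y\<close>, so that \<open>P(S\<^sub>2 > x)\<close> is at least \<open>\<gamma> exp (- \<gamma> x)\<close> times the integral in the
  definition of \<open>OS\<^sup>*\<close>. Hence \<open>F \<in> OS\<^sup>*\<close>.

  For the second claim, a distribution with finite mean lies in \<open>J\<close> if for every \<open>n\<close> its density on
  \<open>[x/n, x]\<close> is at most a multiple of its tail at \<open>x\<close>: when \<open>S\<^sub>n > x\<close> without a summand exceeding
  \<open>x - K\<close>, the largest summand is confined to a part of \<open>[x/n, x]\<close> of length \<open>R - K\<close>, where \<open>R\<close> is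
  the sum of the others, and the mean of the positive part of \<open>R - K\<close> tends to 0 as \<open>K\<close> grows.\<close>

section \<open>Tails of distributions on the reals\<close>

lemma real_distribution_if_unbounded_nonneg:
  "unbounded_nonneg_distribution F \<Longrightarrow> real_distribution F"
  by (simp add: unbounded_nonneg_distribution_def)

lemma (in real_distribution) tail_eq_measure: "tail M x = measure M {x<..}"
proof -
  have "measure M (UNIV - {..x}) = 1 - measure M {..x}"
    using prob_compl[of "{..x}"] by simp
  moreover have "UNIV - {..x} = {x<..}" by auto
  ultimately show ?thesis by (simp add: tail_def cdf_def)
qed

lemma (in real_distribution) emeasure_Ioi: "emeasure M {x<..} = ennreal (tail M x)"
  by (simp add: tail_eq_measure emeasure_eq_measure)

lemma (in real_distribution) tail_nonneg: "0 \<le> tail M x"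
  by (simp add: tail_eq_measure)

lemma (in real_distribution) tail_le_1: "tail M x \<le> 1"
  by (simp add: tail_eq_measure)

lemma (in real_distribution) tail_antimono: "x \<le> y \<Longrightarrow> tail M y \<le> tail M x"
  by (simp add: tail_def cdf_nondecreasing)

lemma (in real_distribution) borel_measurable_tail [measurable]: "tail M \<in> borel_measurable borel"
proof -
  have "(\<lambda>x. - tail M x) \<in> borel_measurable borel"
    by (intro borel_measurable_mono) (auto simp: mono_def tail_antimono)
  then show ?thesis by simp
qed

lemma (in real_distribution) prob_component_gt:
  assumes "i \<in> I"
  shows "measure (\<Pi>\<^sub>M i\<in>I. M) {X \<in> space (\<Pi>\<^sub>M i\<in>I. M). X i > x} = tail M x"
proof -
  have "tail M x = measure (distr (\<Pi>\<^sub>M i\<in>I. M) M (\<lambda>X. X i)) {x<..}"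
    using assms by (subst distr_PiM_component) (auto simp: tail_eq_measure prob_space_axioms)
  also have "\<dots> = measure (\<Pi>\<^sub>M i\<in>I. M) {X \<in> space (\<Pi>\<^sub>M i\<in>I. M). X i > x}"
    using assms by (subst measure_distr) (auto intro!: arg_cong[where f="measure _"])
  finally show ?thesis by simp
qed

lemma AE_nonneg_if_unbounded_nonneg:
  assumes "unbounded_nonneg_distribution F"
  shows "AE y in F. 0 \<le> y"
proof -
  interpret F: real_distribution F by (rule real_distribution_if_unbounded_nonneg[OF assms])
  show ?thesis
    using assms by (subst AE_iff_measurable[of "{..<0}"])
      (auto simp: unbounded_nonneg_distribution_def F.emeasure_eq_measure not_le)
qed

section \<open>The exponential tilt as an independent minimum\<close>

text \<open>A minimum exceeds \<open>x\<close> iff both variables do, so the tails multiply, and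
  \<open>exp (- \<gamma> * x)\<close> is the exponential tail. This coupling allows estimates under
  the tilt without splitting it into an absolutely continuous and a remaining part.\<close>

lemma exp_tilt_eq_distr_min:
  assumes \<gamma>: "\<gamma> > 0" and F: "unbounded_nonneg_distribution F"
  shows "exp_tilt \<gamma> F =
    distr (F \<Otimes>\<^sub>M density lborel (exponential_density \<gamma>)) borel (\<lambda>(a, b). min a b)"
    (is "?G = ?D")
proof -
  let ?E = "density lborel (exponential_density \<gamma>)"
  interpret F: real_distribution F by (rule real_distribution_if_unbounded_nonneg[OF F])
  interpret E: prob_space ?E by (rule prob_space_exponential_density[OF \<gamma>])
  interpret FE: pair_prob_space F ?E ..
  interpret G: real_distribution ?G
    by (rule real_distribution_if_unbounded_nonneg[OF unbounded_nonneg_distribution_exp_tilt[OF \<gamma> F]])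
  have [measurable]: "(\<lambda>(a, b). min a b) \<in> borel_measurable (F \<Otimes>\<^sub>M ?E)"
    by measurable
  interpret D: real_distribution ?D
    by (intro FE.real_distribution_distr) measurable
  have dist: "distributed ?E lborel (\<lambda>x. x) (exponential_density \<gamma>)"
    unfolding distributed_def by (auto simp: distr_id2)
  have Egt: "measure ?E {x<..} = (if x < 0 then 1 else exp (- \<gamma> * x))" for x
  proof (cases "x < 0")
    case False
    then show ?thesis using E.exponential_distributedD_gt[OF dist, of x] \<gamma>
      by (simp add: greaterThan_def mult.commute)
  next
    case True
    have "measure ?E {0<..} = 1"
      using E.exponential_distributedD_gt[OF dist, of 0] \<gamma>
      by (simp add: greaterThan_def)
    moreover have "measure ?E {0<..} \<le> measure ?E {x<..}"
      using True by (intro E.finite_measure_mono) auto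
    ultimately show ?thesis using True E.prob_le_1[of "{x<..}"] by simp
  qed
  \<comment> \<open>The tail of the tilt is 1 by definition at negative arguments, so the product
    formula holds there only because \<open>tail F x\<close> is 1 as well.\<close>
  have F1: "tail F x = 1" if "x < 0" for x
  proof -
    have "measure F {..x} \<le> measure F {..<0}"
      using that by (intro F.finite_measure_mono) auto
    then have "measure F {..x} = 0"
      using F by (intro antisym) (auto simp: unbounded_nonneg_distribution_def)
    then show ?thesis
      by (simp add: tail_def cdf_def)
  qed
  have "tail ?D x = tail ?G x" for x
  proof -
    have "tail ?D x = measure (F \<Otimes>\<^sub>M ?E) ({x<..} \<times> {x<..})"
      unfolding D.tail_eq_measure
      by (subst measure_distr) (auto intro!: arg_cong[where f="measure _"] simp: space_pair_measure)
    also have "\<dots> = measure F {x<..} * measure ?E {x<..}"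
      by (simp add: measure_def E.emeasure_pair_measure_Times enn2real_mult)
    also have "\<dots> = tail ?G x"
      using F1[of x] by (simp add: Egt tail_exp_tilt[OF \<gamma> F] F.tail_eq_measure[symmetric])
    finally show ?thesis .
  qed
  then have "cdf ?G = cdf ?D" by (auto simp: tail_def fun_eq_iff)
  then show ?thesis by (intro cdf_unique) unfold_locales
qed

text \<open>Only the event that the exponential variable is the strictly smaller one is kept. Given
  its value \<open>y\<close>, this event has probability \<open>tail F y\<close>, which weights the
  exponential density.\<close>

lemma nn_integral_exp_tilt_ge:
  assumes \<gamma>: "\<gamma> > 0" and F: "unbounded_nonneg_distribution F"
    and h[measurable]: "h \<in> borel_measurable borel"
  shows "(\<integral>\<^sup>+y. ennreal (exponential_density \<gamma> y * tail F y) * h y \<partial>lborel) \<le> (\<integral>\<^sup>+y. h y \<partial>exp_tilt \<gamma> F)"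
proof -
  let ?E = "density lborel (exponential_density \<gamma>)"
  interpret F: real_distribution F by (rule real_distribution_if_unbounded_nonneg[OF F])
  interpret E: prob_space ?E by (rule prob_space_exponential_density[OF \<gamma>])
  interpret FE: pair_prob_space F ?E ..
  have "(\<integral>\<^sup>+y. ennreal (exponential_density \<gamma> y * tail F y) * h y \<partial>lborel) =
      (\<integral>\<^sup>+y. h y * emeasure F {y<..} \<partial>?E)"
    using \<gamma> exponential_density_nonneg[OF \<gamma>]
    by (subst nn_integral_density)
       (auto simp: F.emeasure_Ioi ennreal_mult F.tail_nonneg mult_ac intro!: nn_integral_cong)
  also have "\<dots> = (\<integral>\<^sup>+y. \<integral>\<^sup>+x. h y * indicator {y<..} x \<partial>F \<partial>?E)"
    by (intro nn_integral_cong, subst nn_integral_cmult_indicator) auto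
  \<comment> \<open>Where the indicator is 1, \<open>y < x\<close> and the minimum is
    \<open>y\<close>; elsewhere the left integrand vanishes.\<close>
  also have "\<dots> \<le> (\<integral>\<^sup>+y. \<integral>\<^sup>+x. h (min x y) \<partial>F \<partial>?E)"
    by (intro nn_integral_mono) (auto simp: indicator_def min_def)
  also have "\<dots> = (\<integral>\<^sup>+p. h (case p of (a, b) \<Rightarrow> min a b) \<partial>(F \<Otimes>\<^sub>M ?E))"
    by (subst FE.nn_integral_snd[symmetric]) (auto simp: split_beta)
  also have "\<dots> = (\<integral>\<^sup>+y. h y \<partial>exp_tilt \<gamma> F)"
    unfolding exp_tilt_eq_distr_min[OF \<gamma> F] by (subst nn_integral_distr) auto
  finally show ?thesis .
qed

section \<open>Convolution tails and the first claim\<close>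

lemma (in real_distribution) emeasure_sum_two_gt:
  "emeasure (\<Pi>\<^sub>M i\<in>{1..2::nat}. M) {X \<in> space (\<Pi>\<^sub>M i\<in>{1..2::nat}. M). (\<Sum>i\<in>{1..2}. X i) > x} =
     (\<integral>\<^sup>+y. ennreal (tail M (x - y)) \<partial>M)"
proof -
  interpret P: product_sigma_finite "\<lambda>_::nat. M" by unfold_locales
  have I: "{1..2::nat} = {1, 2}" by auto
  have S: "{X \<in> space (\<Pi>\<^sub>M i\<in>{1, 2::nat}. M). X 1 + X 2 > x} \<in> sets (\<Pi>\<^sub>M i\<in>{1, 2::nat}. M)"
    by measurable
  have "emeasure (\<Pi>\<^sub>M i\<in>{1, 2::nat}. M) {X \<in> space (\<Pi>\<^sub>M i\<in>{1, 2::nat}. M). X 1 + X 2 > x} =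
      (\<integral>\<^sup>+X. indicator {x<..} (X 1 + X 2) \<partial>(\<Pi>\<^sub>M i\<in>{1, 2::nat}. M))"
    unfolding nn_integral_indicator[OF S, symmetric]
    by (intro nn_integral_cong) (simp add: indicator_def)
  also have "\<dots> = (\<integral>\<^sup>+p. indicator {x<..} (fst p + snd p) \<partial>(M \<Otimes>\<^sub>M M))"
    by (rule P.product_nn_integral_pair) auto
  also have "\<dots> = (\<integral>\<^sup>+y. \<integral>\<^sup>+z. indicator {x<..} (y + z) \<partial>M \<partial>M)"
    by (subst nn_integral_fst[symmetric]) auto
  also have "\<dots> = (\<integral>\<^sup>+y. emeasure M {x - y<..} \<partial>M)"
  proof (intro nn_integral_cong)
    fix y
    have "(\<lambda>z. indicator {x<..} (y + z) :: ennreal) = indicator {x - y<..}"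
      by (auto simp: indicator_def fun_eq_iff)
    then show "(\<integral>\<^sup>+z. indicator {x<..} (y + z) \<partial>M) = emeasure M {x - y<..}"
      by simp
  qed
  finally show ?thesis unfolding I by (simp add: emeasure_Ioi)
qed

text \<open>The right side is P(X + Y > a + b) for independent X, Y, an event that contains X > a
  together with Y > b. It serves to compare tails at shifted arguments.\<close>

lemma (in real_distribution) tail_mult_tail_le:
  "ennreal (tail M a * tail M b) \<le> (\<integral>\<^sup>+y. ennreal (tail M (a + b - y)) \<partial>M)"
proof -
  have "ennreal (tail M a * tail M b) = (\<integral>\<^sup>+y. ennreal (tail M a) * indicator {b<..} y \<partial>M)"
    by (simp add: nn_integral_cmult_indicator emeasure_Ioi ennreal_mult tail_nonneg)
  also have "\<dots> \<le> (\<integral>\<^sup>+y. ennreal (tail M (a + b - y)) \<partial>M)"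
    by (intro nn_integral_mono) (auto simp: indicator_def intro!: ennreal_leI tail_antimono)
  finally show ?thesis .
qed

lemma class_J_convolution_tail_bound:
  assumes G: "G \<in> class_J"
  obtains C x0 where "C > 0"
    "\<And>x. x \<ge> x0 \<Longrightarrow> (\<integral>\<^sup>+y. ennreal (tail G (x - y)) \<partial>G) \<le> ennreal (C * tail G x)"
proof -
  have Gu: "unbounded_nonneg_distribution G" using G by (simp add: class_J_def)
  interpret G: real_distribution G by (rule real_distribution_if_unbounded_nonneg[OF Gu])
  have pos: "tail G x > 0" for x using Gu by (simp add: unbounded_nonneg_distribution_def)
  define M where "M = (\<Pi>\<^sub>M i\<in>{1..2::nat}. G)"
  interpret M: prob_space M unfolding M_def by (intro prob_space_PiM G.prob_space_axioms)
  define S where "S x = {X \<in> space M. (\<Sum>i\<in>{1..2}. X i) > x}" for x :: real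
  define m where "m K x = {X \<in> space M. (MAX i\<in>{1..2::nat}. X i) > x - K \<and> (\<Sum>i\<in>{1..2}. X i) > x}" for K x :: real
  have conv: "emeasure M (S x) = (\<integral>\<^sup>+y. ennreal (tail G (x - y)) \<partial>G)" for x
    unfolding S_def M_def by (rule G.emeasure_sum_two_gt)
  have "((\<lambda>K. Liminf at_top (\<lambda>x. ereal (measure M (m K x) / measure M (S x)))) \<longlongrightarrow> 1) at_top"
    using G by (auto simp: class_J_def M_def m_def S_def cond_prob_def)
  \<comment> \<open>Any constant strictly between 0 and 1 would serve in place of 1/2.\<close>
  then have "\<forall>\<^sub>F K in at_top. Liminf at_top (\<lambda>x. ereal (measure M (m K x) / measure M (S x))) > ereal (1/2)"
    by (rule order_tendstoD) (simp add: one_ereal_def)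
  then obtain K where K: "Liminf at_top (\<lambda>x. ereal (measure M (m K x) / measure M (S x))) > ereal (1/2)"
    by (auto simp: eventually_at_top_linorder)
  from less_LiminfD[OF this] obtain x0 where
    x0: "\<And>x. x \<ge> x0 \<Longrightarrow> measure M (m K x) / measure M (S x) > 1/2"
    by (auto simp: eventually_at_top_linorder)
  have coord: "measure M {X \<in> space M. X i > t} = tail G t" if "i \<in> {1..2}" for i t
    unfolding M_def using that by (rule G.prob_component_gt)
  have bound: "measure M (S x) \<le> 4 * tail G (x - K)" if "x \<ge> x0" for x
  proof -
    \<comment> \<open>A quotient with denominator 0 is 0, so a ratio above 1/2 rules out a null
      event.\<close>
    have Spos: "measure M (S x) > 0"
      using x0[OF that] by (cases "measure M (S x) = 0") (auto simp: zero_less_measure_iff)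
    have [measurable]: "{X \<in> space M. X i > t} \<in> sets M" if "i \<in> {1..2}" for i t
      using that unfolding M_def by measurable
    have "m K x \<subseteq> {X \<in> space M. X 1 > x - K} \<union> {X \<in> space M. X 2 > x - K}"
    proof
      fix X assume "X \<in> m K x"
      then have "X \<in> space M" "\<exists>i\<in>{1..2}. X i > x - K"
        by (auto simp: m_def Max_gr_iff)
      moreover have "{1..2::nat} = {1, 2}" by auto
      ultimately show "X \<in> {X \<in> space M. X 1 > x - K} \<union> {X \<in> space M. X 2 > x - K}" by auto
    qed
    then have "measure M (m K x) \<le> measure M ({X \<in> space M. X 1 > x - K} \<union> {X \<in> space M. X 2 > x - K})"
      by (intro M.finite_measure_mono sets.Un) auto
    also have "\<dots> \<le> measure M {X \<in> space M. X 1 > x - K} + measure M {X \<in> space M. X 2 > x - K}"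
      by (intro measure_Un_le) auto
    also have "\<dots> = 2 * tail G (x - K)" by (simp add: coord)
    finally show ?thesis using x0[OF that] Spos by (simp add: field_simps)
  qed
  \<comment> \<open>The bound is used at \<open>x + K\<close>, where it returns the tail at
    \<open>x\<close>, while \<open>x + K\<close> also splits as \<open>(x - K) + 2 * K\<close>. The
    sign of \<open>K\<close> is unknown, whence the threshold \<open>max x0 (x0 - K)\<close>
    below.\<close>
  have long: "tail G (x - K) \<le> 4 / tail G (2 * K) * tail G x" if "x \<ge> x0 - K" for x
  proof -
    have "ennreal (tail G (x - K) * tail G (2 * K)) \<le> ennreal (measure M (S (x + K)))"
      using G.tail_mult_tail_le[of "x - K" "2 * K"]
      by (simp add: M.emeasure_eq_measure[symmetric] conv algebra_simps)
    then have "tail G (x - K) * tail G (2 * K) \<le> 4 * tail G x"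
      using bound[of "x + K"] that by (subst (asm) ennreal_le_iff) auto
    then show ?thesis using pos[of "2*K"] by (simp add: field_simps)
  qed
  show thesis
  proof (rule that)
    show "4 * (4 / tail G (2 * K)) > 0" using pos by simp
    fix x assume x: "x \<ge> max x0 (x0 - K)"
    have "measure M (S x) \<le> 4 * (4 / tail G (2 * K)) * tail G x"
      using bound[of x] long[of x] x by simp
    then show "(\<integral>\<^sup>+y. ennreal (tail G (x - y)) \<partial>G) \<le> ennreal (4 * (4 / tail G (2 * K)) * tail G x)"
      by (simp add: conv[symmetric] M.emeasure_eq_measure ennreal_leI)
  qed
qed

lemma mean_pos:
  assumes "unbounded_nonneg_distribution F" "integrable F (\<lambda>y. y)"
  shows "(\<integral>y. y \<partial>F) > 0"
proof -
  interpret F: real_distribution F by (rule real_distribution_if_unbounded_nonneg[OF assms(1)])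
  note nn = AE_nonneg_if_unbounded_nonneg[OF assms(1)]
  have "0 < tail F 1" using assms(1) by (simp add: unbounded_nonneg_distribution_def)
  also have "tail F 1 = (\<integral>y. indicator {1<..} y \<partial>F)" by (simp add: F.tail_eq_measure)
  also have "\<dots> \<le> (\<integral>y. y \<partial>F)"
  proof (rule integral_mono_AE[OF _ assms(2)])
    show "integrable F (indicator {1<..} :: real \<Rightarrow> real)"
      by (simp add: F.emeasure_eq_measure)
    show "AE y in F. indicator {1<..} y \<le> y"
      using nn by eventually_elim (simp add: indicator_def)
  qed
  finally show ?thesis .
qed

text \<open>In the convolution of the density
  \<open>\<gamma> * exp (- \<gamma> * y) * tail F y\<close> with the tail of the tilt at
  \<open>x - y\<close>, the exponentials multiply to \<open>exp (- \<gamma> * x)\<close> whatever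
  \<open>y\<close> is. The tail of the tilt at \<open>x\<close> has the same factor, so it cancels
  and the bound \<open>C\<close> becomes \<open>C / \<gamma>\<close> for \<open>F\<close>.\<close>

lemma class_OS_star_if_exp_tilt_in_class_J:
  assumes \<gamma>: "\<gamma> > 0" and F: "unbounded_nonneg_distribution F" "integrable F (\<lambda>y. y)"
    and G: "exp_tilt \<gamma> F \<in> class_J"
  shows "F \<in> class_OS_star"
proof -
  let ?G = "exp_tilt \<gamma> F"
  interpret F: real_distribution F by (rule real_distribution_if_unbounded_nonneg[OF F(1)])
  interpret G: real_distribution ?G
    by (rule real_distribution_if_unbounded_nonneg[OF unbounded_nonneg_distribution_exp_tilt[OF \<gamma> F(1)]])
  have pos: "tail F x > 0" for x using F(1) by (simp add: unbounded_nonneg_distribution_def)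
  obtain C x0 where C: "C > 0"
    "\<And>x. x \<ge> x0 \<Longrightarrow> (\<integral>\<^sup>+y. ennreal (tail ?G (x - y)) \<partial>?G) \<le> ennreal (C * tail ?G x)"
    using class_J_convolution_tail_bound[OF G] by metis
  have bound: "1 / tail F x * (LBINT y:{0..x}. tail F (x - y) * tail F y) \<le> C / \<gamma>"
    if x: "x \<ge> max x0 0" for x
  proof -
    have int: "set_integrable lborel {0..x} (\<lambda>y. tail F (x - y) * tail F y)"
      unfolding set_integrable_def
      by (rule integrableI_bounded_set_indicator[where B=1])
         (use x in \<open>auto simp: F.tail_nonneg F.tail_le_1 abs_mult intro!: mult_le_one\<close>)
    have "ennreal (\<gamma> * exp (- \<gamma> * x) * (LBINT y:{0..x}. tail F (x - y) * tail F y)) =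
        (\<integral>\<^sup>+y. ennreal (\<gamma> * exp (- \<gamma> * x) * (indicator {0..x} y * (tail F (x - y) * tail F y))) \<partial>lborel)"
      using \<gamma> int unfolding set_lebesgue_integral_def set_integrable_def
      by (subst nn_integral_eq_integral) (auto simp: F.tail_nonneg)
    also have "\<dots> \<le> (\<integral>\<^sup>+y. ennreal (exponential_density \<gamma> y * tail F y) * ennreal (tail ?G (x - y)) \<partial>lborel)"
    proof (intro nn_integral_mono)
      fix y :: real
      have "exp (- (\<gamma> * x)) = exp (- (y * \<gamma>)) * exp (- (\<gamma> * (x - y)))"
        by (simp add: exp_add[symmetric] algebra_simps)
      then show "ennreal (\<gamma> * exp (- \<gamma> * x) * (indicator {0..x} y * (tail F (x - y) * tail F y)))
        \<le> ennreal (exponential_density \<gamma> y * tail F y) * ennreal (tail ?G (x - y))"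
        using \<gamma> by (auto simp: indicator_def exponential_density_def tail_exp_tilt[OF \<gamma> F(1)]
              F.tail_nonneg ennreal_mult[symmetric] mult_ac)
    qed
    also have "\<dots> \<le> (\<integral>\<^sup>+y. ennreal (tail ?G (x - y)) \<partial>?G)"
      by (intro nn_integral_exp_tilt_ge[OF \<gamma> F(1)]) auto
    also have "\<dots> \<le> ennreal (C * tail ?G x)" using C(2) x by simp
    finally have "\<gamma> * exp (- \<gamma> * x) * (LBINT y:{0..x}. tail F (x - y) * tail F y)
        \<le> C * (tail F x * exp (- \<gamma> * x))"
      using x C(1) by (subst (asm) ennreal_le_iff) (auto simp: tail_exp_tilt[OF \<gamma> F(1)] F.tail_nonneg)
    then have "\<gamma> * (LBINT y:{0..x}. tail F (x - y) * tail F y) \<le> C * tail F x"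
      by (simp add: mult.assoc[symmetric] mult.commute[of _ "exp _"] mult.left_commute[of _ "exp _"])
    then show ?thesis using \<gamma> pos[of x] by (simp add: field_simps)
  qed
  have "Limsup at_top (\<lambda>x. ereal (1 / tail F x * (LBINT y:{0..x}. tail F (x - y) * tail F y))) \<le> ereal (C / \<gamma>)"
    by (intro Limsup_bounded)
       (use bound in \<open>auto simp: eventually_at_top_linorder intro!: exI[of _ "max x0 0"]\<close>)
  then show ?thesis
    using F mean_pos[OF F] by (auto simp: class_OS_star_def)
qed

section \<open>A sufficient condition for class J\<close>

text \<open>Dominated convergence: at each point the excess is eventually 0, and for nonnegative
  \<open>K\<close> it is dominated by the absolute value of \<open>R\<close>. This is where a finite
  mean is turned into smallness for large \<open>K\<close>.\<close>

lemma expected_excess_tendsto_0: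
  fixes R :: "'a \<Rightarrow> real"
  assumes "integrable M R"
  shows "((\<lambda>K. \<integral>w. max 0 (R w - K) \<partial>M) \<longlongrightarrow> 0) at_top"
proof -
  have [measurable]: "R \<in> borel_measurable M" using assms by auto
  have "((\<lambda>K. \<integral>w. max 0 (R w - K) \<partial>M) \<longlongrightarrow> (\<integral>w. 0 \<partial>M)) at_top"
  proof (rule integral_dominated_convergence_at_top[where w="\<lambda>w. norm (R w)"])
    show "AE w in M. ((\<lambda>K. max 0 (R w - K)) \<longlongrightarrow> 0) at_top"
    proof (intro AE_I2 tendsto_eventually)
      fix w
      show "\<forall>\<^sub>F K in at_top. max 0 (R w - K) = 0"
        using eventually_ge_at_top[of "R w"] by eventually_elim auto
    qed
    show "\<forall>\<^sub>F K in at_top. AE w in M. norm (max 0 (R w - K)) \<le> norm (R w)"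
      using eventually_ge_at_top[of 0] by eventually_elim auto
  qed (use assms in auto)
  then show ?thesis by simp
qed

lemma (in prob_space) integrable_PiM_sum:
  fixes f :: "'a \<Rightarrow> real"
  assumes "finite I" "integrable M f"
  shows "integrable (\<Pi>\<^sub>M i\<in>I. M) (\<lambda>w. \<Sum>i\<in>I. f (w i))"
proof (intro Bochner_Integration.integrable_sum)
  fix i assume i: "i \<in> I"
  have "integrable (distr (\<Pi>\<^sub>M i\<in>I. M) M (\<lambda>w. w i)) f"
    using assms i by (subst distr_PiM_component) (auto simp: prob_space_axioms)
  then show "integrable (\<Pi>\<^sub>M i\<in>I. M) (\<lambda>w. f (w i))"
    using i by (subst (asm) integrable_distr_eq) (use assms in auto)
qed

text \<open>Almost surely no summand is negative, so a single summand is at most the sum. This lets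
  error terms proportional to \<open>tail F x\<close> be absorbed into P(S_n > x), which is the
  denominator of the conditional probability.\<close>

lemma tail_le_prob_sum_gt:
  assumes F: "unbounded_nonneg_distribution F" and I: "finite I" "I \<noteq> {}"
  shows "tail F x \<le> measure (\<Pi>\<^sub>M i\<in>I. F) {X \<in> space (\<Pi>\<^sub>M i\<in>I. F). (\<Sum>i\<in>I. X i) > x}"
proof -
  interpret F: real_distribution F by (rule real_distribution_if_unbounded_nonneg[OF F])
  define M where "M = (\<Pi>\<^sub>M i\<in>I. F)"
  interpret M: prob_space M unfolding M_def by (intro prob_space_PiM F.prob_space_axioms)
  from I obtain i where i: "i \<in> I" by auto
  have "tail F x = measure M {X \<in> space M. X i > x}"
    unfolding M_def using i by (rule F.prob_component_gt[symmetric])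
  also have "\<dots> \<le> measure M {X \<in> space M. (\<Sum>i\<in>I. X i) > x}"
  proof (rule M.finite_measure_mono_AE)
    have "AE X in M. X j \<ge> 0" if "j \<in> I" for j
      unfolding M_def using that AE_nonneg_if_unbounded_nonneg[OF F]
      by (intro AE_PiM_component F.prob_space_axioms) auto
    then have "AE X in M. \<forall>j\<in>I. X j \<ge> 0"
      using I by (auto intro!: AE_finite_allI)
    then show "AE X in M. X \<in> {X \<in> space M. X i > x} \<longrightarrow> X \<in> {X \<in> space M. (\<Sum>i\<in>I. X i) > x}"
    proof eventually_elim
      fix X :: "_ \<Rightarrow> real" assume "\<forall>j\<in>I. X j \<ge> 0"
      then have "X i \<le> (\<Sum>i\<in>I. X i)"
        using I i by (intro member_le_sum) auto
      then show "X \<in> {X \<in> space M. X i > x} \<longrightarrow> X \<in> {X \<in> space M. (\<Sum>i\<in>I. X i) > x}"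
        by auto
    qed
    have "(\<lambda>X. \<Sum>i\<in>I. X i) \<in> borel_measurable M"
      unfolding M_def by (intro borel_measurable_sum) measurable
    then show "{X \<in> space M. (\<Sum>i\<in>I. X i) > x} \<in> sets M"
      by measurable
  qed
  finally show ?thesis unfolding M_def .
qed

text \<open>Given the sum \<open>R\<close> of the other variables, \<open>X i\<close> is confined to an interval of length
  at most \<open>R - K\<close>.\<close>

lemma (in real_distribution) prob_intermediate_jump_le:
  fixes i :: 'b
  assumes I: "finite I" "i \<in> I" and K: "K \<ge> 0" and D: "D \<ge> 0"
    and int: "integrable M (\<lambda>y. y)"
    and dens: "\<And>a b. c \<le> a \<Longrightarrow> a \<le> b \<Longrightarrow> b \<le> x \<Longrightarrow> measure M {a<..b} \<le> D * (b - a)"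
  shows "measure (\<Pi>\<^sub>M i\<in>I. M) {X \<in> space (\<Pi>\<^sub>M i\<in>I. M). c < X i \<and> X i \<le> x - K \<and> (\<Sum>i\<in>I. X i) > x}
    \<le> D * (\<integral>w. max 0 ((\<Sum>j\<in>I-{i}. w j) - K) \<partial>(\<Pi>\<^sub>M i\<in>I-{i}. M))"
    (is "measure ?M ?A \<le> D * (\<integral>w. ?g w \<partial>?N)")
proof -
  interpret P: product_sigma_finite "\<lambda>_. M" by unfold_locales
  interpret PM: prob_space ?M by (intro prob_space_PiM prob_space_axioms)
  have ins: "insert i (I - {i}) = I" using I by auto
  have [measurable]: "(\<lambda>X. X j) \<in> borel_measurable ?M" if "j \<in> I" for j
    using that by measurable
  note [measurable] = this[OF I(2)]
  have "(\<lambda>X. \<Sum>j\<in>I. X j) \<in> borel_measurable ?M"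
    by (intro borel_measurable_sum) simp
  then have A: "?A \<in> sets ?M" by measurable
  interpret PN: prob_space ?N by (intro prob_space_PiM prob_space_axioms)
  have gint: "integrable ?N ?g"
    using I int by (intro integrable_max integrable_PiM_sum Bochner_Integration.integrable_diff) auto
  have "ennreal (measure ?M ?A) = (\<integral>\<^sup>+X. indicator ?A X \<partial>?M)"
    using A by (simp add: PM.emeasure_eq_measure)
  \<comment> \<open>Fubini separates the coordinate \<open>i\<close> from the others, so that the
    density bound can be applied for fixed \<open>w\<close>.\<close>
  also have "\<dots> = (\<integral>\<^sup>+w. \<integral>\<^sup>+y. indicator ?A (w(i := y)) \<partial>M \<partial>?N)"
    using P.product_nn_integral_insert[of "I - {i}" i "indicator ?A", unfolded ins] I A
    by simp
  also have "\<dots> \<le> (\<integral>\<^sup>+w. ennreal (D * ?g w) \<partial>?N)"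
  proof (intro nn_integral_mono)
    fix w :: "'b \<Rightarrow> real"
    define R where "R = (\<Sum>j\<in>I-{i}. w j)"
    let ?J = "{max c (x - R)<..x - K}"
    have sum: "(\<Sum>j\<in>I. (w(i := y)) j) = y + R" for y
    proof -
      have "(\<Sum>j\<in>I. (w(i := y)) j) = (w(i := y)) i + (\<Sum>j\<in>I-{i}. (w(i := y)) j)"
        using I by (intro sum.remove) auto
      also have "(\<Sum>j\<in>I-{i}. (w(i := y)) j) = R"
        unfolding R_def by (intro sum.cong) auto
      finally show ?thesis by simp
    qed
    have "(\<integral>\<^sup>+y. indicator ?A (w(i := y)) \<partial>M) \<le> (\<integral>\<^sup>+y. indicator ?J y \<partial>M)"
    proof (intro nn_integral_mono)
      fix y
      show "indicator ?A (w(i := y)) \<le> (indicator ?J y :: ennreal)"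
        using sum[of y] by (auto simp: indicator_def simp del: fun_upd_apply split: if_splits) auto
    qed
    also have "\<dots> = ennreal (measure M ?J)"
      by (simp add: emeasure_eq_measure)
    also have "measure M ?J \<le> D * max 0 (R - K)"
    \<comment> \<open>If the endpoints are in the wrong order, the interval is empty. Otherwise its
      length is at most \<open>R - K\<close>, and \<open>K \<ge> 0\<close> keeps it below
      \<open>x\<close>, as \<open>dens\<close> demands.\<close>
    proof (cases "max c (x - R) \<le> x - K")
      case True
      then have "measure M ?J \<le> D * (x - K - max c (x - R))"
        using K by (intro dens) auto
      also have "\<dots> \<le> D * max 0 (R - K)" using D by (intro mult_left_mono) auto
      finally show ?thesis .
    qed (use D in auto)
    finally show "(\<integral>\<^sup>+y. indicator ?A (w(i := y)) \<partial>M) \<le> ennreal (D * ?g w)"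
      unfolding R_def by (simp add: ennreal_leI)
  qed
  also have "\<dots> = ennreal (D * (\<integral>w. ?g w \<partial>?N))"
    using gint D by (subst nn_integral_eq_integral) auto
  finally show ?thesis
    using D by (subst (asm) ennreal_le_iff) (auto intro!: mult_nonneg_nonneg integral_nonneg_AE)
qed

lemma class_J_if_local_density_bound:
  assumes F: "unbounded_nonneg_distribution F" and int: "integrable F (\<lambda>y. y)"
    and dens: "\<And>n. n \<ge> 2 \<Longrightarrow> \<exists>C\<ge>0. \<exists>x0. \<forall>x\<ge>x0. \<forall>a b. x / real n \<le> a \<longrightarrow> a \<le> b \<longrightarrow> b \<le> x \<longrightarrow>
      measure F {a<..b} \<le> C * tail F x * (b - a)"
  shows "F \<in> class_J"
proof -
  interpret F: real_distribution F by (rule real_distribution_if_unbounded_nonneg[OF F])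
  have pos: "tail F x > 0" for x using F by (simp add: unbounded_nonneg_distribution_def)
  have "((\<lambda>K. Liminf at_top (\<lambda>x. ereal (\<P>(X in (\<Pi>\<^sub>M i\<in>{1..n}. F).
          (MAX i\<in>{1..n}. X i) > x - K \<bar> (\<Sum>i\<in>{1..n}. X i) > x)))) \<longlongrightarrow> 1) at_top"
    if n: "n \<ge> 2" for n :: nat
  proof -
    define M where "M = (\<Pi>\<^sub>M i\<in>{1..n}. F)"
    interpret M: prob_space M unfolding M_def by (intro prob_space_PiM F.prob_space_axioms)
    define S where "S x = {X \<in> space M. (\<Sum>i\<in>{1..n}. X i) > x}" for x :: real
    define m where "m K x = {X \<in> space M. (MAX i\<in>{1..n}. X i) > x - K \<and> (\<Sum>i\<in>{1..n}. X i) > x}" for K x :: real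
    define A where "A i K x = {X \<in> space M. x / n < X i \<and> X i \<le> x - K \<and> (\<Sum>i\<in>{1..n}. X i) > x}" for i and K x :: real
    have [measurable]: "S x \<in> sets M" for x
      unfolding S_def M_def by measurable
    have [measurable]: "m K x \<in> sets M" for K x
      using n unfolding m_def M_def by measurable
    have [measurable]: "A i K x \<in> sets M" if "i \<in> {1..n}" for i K x
      using that unfolding A_def M_def by measurable
    obtain C x0 where C: "C \<ge> 0" and x0: "\<And>x a b. x \<ge> x0 \<Longrightarrow> x / real n \<le> a \<Longrightarrow> a \<le> b \<Longrightarrow> b \<le> x \<Longrightarrow>
      measure F {a<..b} \<le> C * tail F x * (b - a)"
      using dens[OF n] by blast
    \<comment> \<open>The error relative to P(S_n > x), uniform in \<open>x\<close>: the factor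
      \<open>tail F x\<close> of the density bound has already been divided out.\<close>
    define e where "e K = (\<Sum>i\<in>{1..n}. C * (\<integral>w. max 0 ((\<Sum>j\<in>{1..n}-{i}. w j) - K) \<partial>(\<Pi>\<^sub>M i\<in>{1..n}-{i}. F)))" for K
    have e: "(e \<longlongrightarrow> 0) at_top"
    proof -
      have "(e \<longlongrightarrow> (\<Sum>i\<in>{1..n}. C * 0)) at_top"
        unfolding e_def
        by (intro tendsto_sum tendsto_mult tendsto_const expected_excess_tendsto_0 F.integrable_PiM_sum int) auto
      then show ?thesis by simp
    qed
    let ?L = "\<lambda>K. Liminf at_top (\<lambda>x. ereal (measure M (m K x) / measure M (S x)))"
    have ge: "1 - e K \<le> measure M (m K x) / measure M (S x)" if K: "K \<ge> 0" and x: "x \<ge> x0" for K x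
    proof -
      have Sx: "tail F x \<le> measure M (S x)"
        unfolding S_def M_def using n by (intro tail_le_prob_sum_gt[OF F]) auto
      have "S x \<subseteq> m K x \<union> (\<Union>i\<in>{1..n}. A i K x)"
      proof
        fix X assume X: "X \<in> S x"
        show "X \<in> m K x \<union> (\<Union>i\<in>{1..n}. A i K x)"
        proof (cases "(MAX i\<in>{1..n}. X i) > x - K")
          case False
          then have le: "X i \<le> x - K" if "i \<in> {1..n}" for i
            using that by (subst (asm) not_less, subst (asm) Max_le_iff) auto
          \<comment> \<open>Pigeonhole: a sum above \<open>x\<close> needs a summand above the
            average \<open>x / n\<close>. It is this summand that takes an intermediate
            value.\<close>
          have "\<exists>i\<in>{1..n}. x / n < X i"
          proof (rule ccontr)
            assume "\<not> ?thesis"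
            then have "(\<Sum>i\<in>{1..n}. X i) \<le> (\<Sum>i\<in>{1..n}. x / n)"
              by (intro sum_mono) (auto simp: not_less)
            also have "\<dots> = x" using n by simp
            finally show False using X by (simp add: S_def)
          qed
          then show ?thesis using X le by (auto simp: S_def A_def)
        qed (use X in \<open>auto simp: S_def m_def\<close>)
      qed
      then have "measure M (S x) \<le> measure M (m K x \<union> (\<Union>i\<in>{1..n}. A i K x))"
        by (intro M.finite_measure_mono) auto
      also have "\<dots> \<le> measure M (m K x) + measure M (\<Union>i\<in>{1..n}. A i K x)"
        by (intro measure_Un_le) auto
      also have "measure M (\<Union>i\<in>{1..n}. A i K x) \<le> (\<Sum>i\<in>{1..n}. measure M (A i K x))"
        by (intro measure_UNION_le) auto
      also have "\<dots> \<le> (\<Sum>i\<in>{1..n}. (C * tail F x) *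
          (\<integral>w. max 0 ((\<Sum>j\<in>{1..n}-{i}. w j) - K) \<partial>(\<Pi>\<^sub>M i\<in>{1..n}-{i}. F)))"
        unfolding A_def M_def using C K x0[OF x]
        by (intro sum_mono F.prob_intermediate_jump_le int) (auto simp: F.tail_nonneg)
      also have "\<dots> = e K * tail F x"
        unfolding e_def sum_distrib_right by (intro sum.cong) auto
      also have "\<dots> \<le> e K * measure M (S x)"
        using C Sx by (intro mult_left_mono) (auto simp: e_def intro!: sum_nonneg mult_nonneg_nonneg integral_nonneg_AE)
      finally have "(1 - e K) * measure M (S x) \<le> measure M (m K x)"
        by (simp add: algebra_simps)
      then show ?thesis
        using Sx pos[of x] by (subst pos_le_divide_eq) auto
    qed
    have "(?L \<longlongrightarrow> ereal 1) at_top"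
    proof (rule tendsto_sandwich)
      show "\<forall>\<^sub>F K in at_top. ereal (1 - e K) \<le> ?L K"
        using eventually_ge_at_top[of 0]
      proof eventually_elim
        fix K :: real assume K: "0 \<le> K"
        show "ereal (1 - e K) \<le> ?L K"
          using ge[OF K] by (intro Liminf_bounded) (auto simp: eventually_at_top_linorder)
      qed
      have "measure M (m K x) / measure M (S x) \<le> 1" for K x
      proof -
        have "measure M (m K x) \<le> measure M (S x)"
        proof (rule M.finite_measure_mono)
          show "m K x \<subseteq> S x" by (auto simp: m_def S_def)
        qed measurable
        then show ?thesis by (auto simp: divide_le_eq_1 zero_less_measure_iff)
      qed
      then show "\<forall>\<^sub>F K in at_top. ?L K \<le> ereal 1"
        by (intro always_eventually allI order.trans[OF Liminf_le_Limsup] Limsup_bounded) auto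
      show "((\<lambda>K. ereal (1 - e K)) \<longlongrightarrow> ereal 1) at_top"
        using tendsto_diff[OF tendsto_const e, of 1] by simp
    qed auto
    then show ?thesis
      by (simp add: m_def S_def M_def cond_prob_def one_ereal_def)
  qed
  then show ?thesis using F by (auto simp: class_J_def)
qed

section \<open>A heavy-tailed distribution on sparse blocks\<close>

text \<open>The example has a constant density \<open>level (Suc k)\<close> on the sparse blocks below, such
  that its tail is \<open>level k\<close> just before block \<open>k\<close>. The tail drops by a factor tending to infinity
  over each block, which excludes \<open>OS\<^sup>*\<close>, while the density never exceeds the subsequent tail, which
  gives \<open>J\<close>.\<close>

definition level :: "nat \<Rightarrow> real" where "level k = (1/2) ^ (k * Suc k)"
definition onset :: "nat \<Rightarrow> real" where "onset k = 2 ^ (k\<^sup>2 + 2)"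
text \<open>Chosen so that the density \<open>level (Suc k)\<close> gives block \<open>k\<close>
  exactly the mass \<open>level k - level (Suc k)\<close>; the block masses then telescope.\<close>

definition width :: "nat \<Rightarrow> real" where "width k = 4 ^ Suc k - 1"
definition block :: "nat \<Rightarrow> real set" where "block k = {onset k..onset k + width k}"

definition block_distr :: "real measure" where
  "block_distr = density lborel (\<lambda>y. \<Sum>k. ennreal (level (Suc k)) * indicator (block k) y)"

lemma level_pos: "level k > 0" by (simp add: level_def)
lemma onset_pos: "onset k > 0" by (simp add: onset_def)
lemma width_nonneg: "width k \<ge> 0"
  unfolding width_def using one_le_power[of "4::real" "Suc k"] by linarith

lemma level_Suc: "level k = 4 ^ Suc k * level (Suc k)"
proof -
  have "(1/2::real) ^ (Suc k * Suc (Suc k)) = (1/2) ^ (k * Suc k) * ((1/2)\<^sup>2) ^ Suc k"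
    unfolding power_mult[symmetric] power_add[symmetric] by (intro arg_cong2[where f=power]) (auto simp: algebra_simps)
  then show ?thesis by (simp add: level_def power2_eq_square power_divide field_simps)
qed

lemma level_Suc_mult_width: "level (Suc k) * width k = level k - level (Suc k)"
  unfolding width_def by (subst level_Suc[of k]) (simp add: algebra_simps)

lemma onset_Suc: "onset (Suc k) = 2 * 4 ^ k * onset k"
proof -
  have "(2::real) ^ ((Suc k)\<^sup>2 + 2) = 2 * (2\<^sup>2) ^ k * 2 ^ (k\<^sup>2 + 2)"
    unfolding power_mult[symmetric] power_add[symmetric] power_Suc[symmetric]
    by (intro arg_cong2[where f=power]) (auto simp: power2_eq_square algebra_simps)
  then show ?thesis by (simp add: onset_def)
qed

text \<open>The balance behind the example. The product is summable, which gives a finite mean;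
  multiplied by \<open>onset k\<close> it is unbounded, which gives a heavy tail; multiplied by the
  tail ratio \<open>4 ^ Suc k\<close> it is unbounded, which violates OS*.\<close>

lemma level_mult_onset: "level k * onset k = 4 * (1/2) ^ k"
  by (simp add: level_def onset_def power_add power2_eq_square field_simps power_one_over)

lemma four_power: "(4::real) ^ k = 2 ^ (2 * k)" by (simp add: power_mult)

lemma width_less_half_onset_Suc: "width k < onset (Suc k) / 2"
proof -
  have "(4::real) ^ Suc k \<le> 2 ^ ((Suc k)\<^sup>2 + 1)"
    unfolding four_power by (intro power_increasing) (auto simp: power2_eq_square)
  then show ?thesis by (simp add: width_def onset_def)
qed

text \<open>Puts block \<open>k\<close> below \<open>3 * onset k\<close>, the source of the
  constants 3 and 12 in the estimates of the mean and of the density.\<close>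

lemma width_le_2_onset: "width k \<le> 2 * onset k"
proof -
  have "2 * Suc k \<le> k\<^sup>2 + 3"
    by (cases k) (auto simp: power2_eq_square)
  then have "(4::real) ^ Suc k \<le> 2 ^ (k\<^sup>2 + 3)"
    unfolding four_power by (intro power_increasing) auto
  then show ?thesis by (simp add: width_def onset_def eval_nat_numeral)
qed

text \<open>Ensures that block \<open>k\<close> has ended at \<open>3/2 * onset k\<close>, where OS*
  is refuted. At \<open>k = 2\<close> it fails, with width 63 against 32.\<close>

lemma width_le_half_onset: "k \<ge> 3 \<Longrightarrow> width k \<le> onset k / 2"
proof -
  assume "k \<ge> 3"
  then have "3 * k \<le> k\<^sup>2" by (simp add: power2_eq_square)
  with \<open>k \<ge> 3\<close> have "2 * Suc k \<le> k\<^sup>2 + 1" unfolding mult_Suc_right by linarith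
  then have "(4::real) ^ Suc k \<le> 2 ^ (k\<^sup>2 + 1)"
    unfolding four_power by (intro power_increasing) auto
  then show ?thesis by (simp add: width_def onset_def)
qed

lemma onset_ge_4_power: "2 * 4 ^ k \<le> onset k"
proof -
  have "2 * k + 1 \<le> k\<^sup>2 + 2"
    by (cases k) (auto simp: power2_eq_square)
  then have "(2::real) ^ (2 * k + 1) \<le> 2 ^ (k\<^sup>2 + 2)" by (intro power_increasing) auto
  then show ?thesis by (simp add: onset_def four_power)
qed

lemma block_end_less: "onset k + width k < onset (Suc k)"
proof -
  have "1 * onset k \<le> 4 ^ k * onset k"
    using onset_pos[of k] by (intro mult_right_mono) auto
  then show ?thesis using width_less_half_onset_Suc[of k] onset_Suc[of k] by simp
qed

lemma onset_mono: "i \<le> j \<Longrightarrow> onset i \<le> onset j"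
  by (auto simp: onset_def intro!: power_increasing power_mono)

lemma block_end_less_onset: "i < j \<Longrightarrow> onset i + width i < onset j"
  using block_end_less[of i] onset_mono[of "Suc i" j] by simp

lemma disjoint_block: "disjoint_family block"
proof (unfold disjoint_family_on_def, intro ballI impI)
  fix i j :: nat assume "i \<noteq> j"
  then show "block i \<inter> block j = {}"
    using block_end_less_onset[of i j] block_end_less_onset[of j i]
    by (cases "i < j") (auto simp: block_def)
qed

section \<open>The block distribution and its tail\<close>

lemma block_sets [measurable]: "block k \<in> sets borel" by (simp add: block_def)

lemma sets_block_distr [simp, measurable_cong]: "sets block_distr = sets borel"
  by (simp add: block_distr_def)

lemma space_block_distr [simp]: "space block_distr = UNIV"
  by (simp add: block_distr_def)

lemma nn_integral_block_distr:
  assumes [measurable]: "h \<in> borel_measurable borel"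
  shows "(\<integral>\<^sup>+y. h y \<partial>block_distr) = (\<Sum>k. ennreal (level (Suc k)) * (\<integral>\<^sup>+y\<in>block k. h y \<partial>lborel))"
proof -
  have "(\<integral>\<^sup>+y. h y \<partial>block_distr) = (\<integral>\<^sup>+y. (\<Sum>k. ennreal (level (Suc k)) * indicator (block k) y) * h y \<partial>lborel)"
    unfolding block_distr_def by (subst nn_integral_density) auto
  also have "\<dots> = (\<integral>\<^sup>+y. (\<Sum>k. ennreal (level (Suc k)) * (h y * indicator (block k) y)) \<partial>lborel)"
    by (intro nn_integral_cong) (simp add: mult_ac flip: ennreal_suminf_multc)
  also have "\<dots> = (\<Sum>k. ennreal (level (Suc k)) * (\<integral>\<^sup>+y\<in>block k. h y \<partial>lborel))"
    by (subst nn_integral_suminf) (auto simp: nn_integral_cmult)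
  finally show ?thesis .
qed

lemma emeasure_block_distr:
  assumes "A \<in> sets borel"
  shows "emeasure block_distr A = (\<Sum>k. ennreal (level (Suc k)) * emeasure lborel (A \<inter> block k))"
proof -
  have "(\<integral>\<^sup>+y\<in>block k. indicator A y \<partial>lborel) = emeasure lborel (A \<inter> block k)" for k
  proof -
    have "(\<lambda>y. indicator A y * indicator (block k) y :: ennreal) = indicator (A \<inter> block k)"
      by (auto simp: indicator_def fun_eq_iff)
    then show ?thesis using assms by simp
  qed
  then show ?thesis
    using assms nn_integral_block_distr[of "indicator A"] by simp
qed

lemma emeasure_lborel_block: "emeasure lborel (block k) = ennreal (width k)"
  using width_nonneg[of k] by (simp add: block_def)

lemma block_mass: "ennreal (level (Suc k)) * emeasure lborel (block k) = ennreal (level k - level (Suc k))"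
  using level_pos[of "Suc k"] width_nonneg[of k]
  by (simp add: emeasure_lborel_block level_Suc_mult_width flip: ennreal_mult)

lemma level_tendsto_0: "level \<longlonglongrightarrow> 0"
proof (rule tendsto_sandwich[of "\<lambda>_. 0"])
  show "\<forall>\<^sub>F k in sequentially. level k \<le> (1/2) ^ k"
    by (intro always_eventually allI) (auto simp: level_def intro!: power_decreasing)
qed (auto simp: level_pos less_imp_le LIMSEQ_realpow_zero intro!: always_eventually)

lemma level_Suc_le_quarter: "level (Suc k) \<le> level k / 4"
proof -
  have "1 * level (Suc k) \<le> 4 ^ k * level (Suc k)"
    using level_pos[of "Suc k"] by (intro mult_right_mono) auto
  then show ?thesis by (subst level_Suc) simp
qed

lemma level_decseq: "level (Suc k) \<le> level k"
  using level_Suc_le_quarter[of k] level_pos[of k] by simp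

text \<open>The case \<open>m = 0\<close> yields total mass 1, the case \<open>m = Suc k\<close> the
  tail beyond block \<open>k\<close>.\<close>

lemma block_mass_tail_sum: "(\<Sum>k. ennreal (if m \<le> k then level k - level (Suc k) else 0)) = ennreal (level m)"
proof -
  let ?g = "\<lambda>k. if m \<le> k then level k - level (Suc k) else 0"
  have "(\<lambda>k. level (k + m) - level (Suc k + m)) sums (level (0 + m) - 0)"
    by (intro telescope_sums' LIMSEQ_ignore_initial_segment level_tendsto_0)
  then have "(\<lambda>k. ?g (k + m)) sums level m" by simp
  then have "?g sums level m"
    by (subst (asm) sums_iff_shift) (simp add: sum.neutral)
  then show ?thesis
    using level_decseq by (intro suminf_ennreal_eq) auto
qed

lemma real_distribution_block_distr: "real_distribution block_distr"
proof -
  have "emeasure block_distr UNIV = (\<Sum>k. ennreal (level k - level (Suc k)))"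
    by (subst emeasure_block_distr) (simp_all add: block_mass)
  also have "\<dots> = ennreal (level 0)"
    using block_mass_tail_sum[of 0] by simp
  finally have "emeasure block_distr UNIV = ennreal (level 0)" .
  then show ?thesis
    by (intro real_distribution.intro prob_spaceI real_distribution_axioms.intro) (auto simp: level_def)
qed

interpretation BD: real_distribution block_distr by (rule real_distribution_block_distr)

lemma emeasure_block_distr_block: "emeasure block_distr (block k) = ennreal (level k - level (Suc k))"
proof -
  have "emeasure block_distr (block k) = (\<Sum>j. if j = k then ennreal (level k - level (Suc k)) else 0)"
  proof (subst emeasure_block_distr, simp, intro suminf_cong)
    fix j
    have "block k \<inter> block j = {}" if "j \<noteq> k"
      using disjoint_block that by (auto simp: disjoint_family_on_def)
    then show "ennreal (level (Suc j)) * emeasure lborel (block k \<inter> block j) =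
        (if j = k then ennreal (level k - level (Suc k)) else 0)"
      by (auto simp: block_mass)
  qed
  also have "\<dots> = ennreal (level k - level (Suc k))"
    by (subst suminf_finite[of "{k}"]) auto
  finally show ?thesis .
qed

text \<open>Block \<open>k\<close> alone suffices: it lies beyond \<open>x\<close> and carries at
  least three quarters of \<open>level k\<close>.\<close>

lemma tail_block_distr_ge:
  assumes "x < onset k"
  shows "level k / 2 \<le> tail block_distr x"
proof -
  have "ennreal (level k - level (Suc k)) \<le> emeasure block_distr {x<..}"
    unfolding emeasure_block_distr_block[symmetric]
    using assms by (intro emeasure_mono) (auto simp: block_def)
  then have "level k - level (Suc k) \<le> tail block_distr x"
    using BD.tail_nonneg by (simp add: BD.emeasure_Ioi ennreal_le_iff)
  then show ?thesis using level_Suc_le_quarter[of k] level_pos[of k] by simp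
qed

lemma tail_block_distr_le:
  assumes "onset k + width k \<le> x"
  shows "tail block_distr x \<le> level (Suc k)"
proof -
  have "emeasure block_distr {x<..} \<le> (\<Sum>j. ennreal (if Suc k \<le> j then level j - level (Suc j) else 0))"
  proof (subst emeasure_block_distr, simp, intro suminf_le summableI)
    fix j
    have "{x<..} \<inter> block j = {}" if "j \<le> k"
    proof -
      have "onset j + width j \<le> x"
        using assms block_end_less_onset[of j k] width_nonneg[of k] that by (cases "j = k") auto
      then show ?thesis by (auto simp: block_def)
    qed
    moreover have "ennreal (level (Suc j)) * emeasure lborel ({x<..} \<inter> block j) \<le> ennreal (level j - level (Suc j))"
      unfolding block_mass[symmetric] by (intro mult_left_mono emeasure_mono) auto
    ultimately show "ennreal (level (Suc j)) * emeasure lborel ({x<..} \<inter> block j) \<le>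
        ennreal (if Suc k \<le> j then level j - level (Suc j) else 0)"
      by auto
  qed
  then show ?thesis
    using level_pos[of "Suc k"] by (simp add: block_mass_tail_sum BD.emeasure_Ioi ennreal_le_iff)
qed

lemma onset_at_top: "filterlim onset at_top sequentially"
proof (rule filterlim_at_top_mono[OF filterlim_real_sequentially])
  have "real k \<le> onset k" for k
  proof -
    have "k \<le> k\<^sup>2 + 2"
      by (cases k) (auto simp: power2_eq_square)
    then have "(2::real) ^ k \<le> onset k"
      unfolding onset_def by (intro power_increasing) auto
    then show ?thesis using of_nat_less_two_power[of k, where 'a=real] by linarith
  qed
  then show "\<forall>\<^sub>F k in sequentially. real k \<le> onset k" by simp
qed

lemma unbounded_nonneg_block_distr: "unbounded_nonneg_distribution block_distr"
  unfolding unbounded_nonneg_distribution_def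
proof (intro conjI allI real_distribution_block_distr)
  have "{..<0} \<inter> block k = {}" for k
    using onset_pos[of k] by (auto simp: block_def)
  then have "emeasure block_distr {..<0} = 0"
    by (subst emeasure_block_distr) auto
  then show "measure block_distr {..<0} = 0" by (simp add: measure_def)
  fix x :: real
  obtain k where "x < onset k"
    using onset_at_top by (auto simp: filterlim_at_top_dense eventually_sequentially)
  then show "tail block_distr x > 0"
    using tail_block_distr_ge[of x k] level_pos[of k] by simp
qed

section \<open>Class memberships of the block distribution\<close>

lemma integrable_block_distr: "integrable block_distr (\<lambda>y. y)"
proof (rule integrableI_bounded)
  \<comment> \<open>Block \<open>k\<close> has mass at most \<open>level k\<close> and points at
    most \<open>3 * onset k\<close>, and \<open>level k * onset k\<close> is
    \<open>4 * (1/2) ^ k\<close>.\<close>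
  have "(\<integral>\<^sup>+y. ennreal (norm y) \<partial>block_distr) \<le> (\<Sum>k. ennreal (12 * (1/2) ^ k))"
  proof (subst nn_integral_block_distr, simp, intro suminf_le summableI)
    fix k
    have "(\<integral>\<^sup>+y\<in>block k. ennreal (norm y) \<partial>lborel) \<le> (\<integral>\<^sup>+y. ennreal (3 * onset k) * indicator (block k) y \<partial>lborel)"
      using onset_pos[of k] width_le_2_onset[of k]
      by (intro nn_integral_mono) (auto simp: block_def indicator_def intro!: ennreal_leI)
    also have "\<dots> = ennreal (3 * onset k) * ennreal (width k)"
      by (subst nn_integral_cmult_indicator) (auto simp: emeasure_lborel_block)
    finally have "ennreal (level (Suc k)) * (\<integral>\<^sup>+y\<in>block k. ennreal (norm y) \<partial>lborel)
        \<le> ennreal (level (Suc k)) * (ennreal (3 * onset k) * ennreal (width k))"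
      by (intro mult_left_mono) auto
    also have "\<dots> = ennreal ((level (Suc k) * width k) * (3 * onset k))"
      using level_pos[of "Suc k"] onset_pos[of k] width_nonneg[of k] by (simp add: ennreal_mult mult_ac)
    also have "(level (Suc k) * width k) * (3 * onset k) \<le> level k * (3 * onset k)"
      unfolding level_Suc_mult_width using level_pos[of "Suc k"] onset_pos[of k]
      by (intro mult_right_mono) auto
    also have "\<dots> = 12 * (1/2) ^ k"
      using level_mult_onset[of k] by simp
    finally show "ennreal (level (Suc k)) * (\<integral>\<^sup>+y\<in>block k. ennreal (norm y) \<partial>lborel) \<le> ennreal (12 * (1/2) ^ k)"
      by (simp add: ennreal_leI)
  qed
  also have "\<dots> = ennreal (\<Sum>k. 12 * (1/2) ^ k)"
    by (intro suminf_ennreal2 summable_mult summable_geometric) auto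
  finally show "(\<integral>\<^sup>+y. ennreal (norm y) \<partial>block_distr) < \<infinity>"
    by (simp add: le_less_trans)
qed simp

text \<open>The second moment is already infinite. By \<open>exp t \<ge> t\<^sup>2 / 2\<close> for
  positive \<open>t\<close>, block \<open>k\<close> alone contributes at least
  \<open>l\<^sup>2 * 2 ^ k\<close>, which is unbounded in \<open>k\<close>.\<close>

lemma block_distr_in_class_K: "block_distr \<in> class_K"
  unfolding class_K_def
proof (intro CollectI conjI allI impI unbounded_nonneg_block_distr)
  fix l :: real assume l: "l > 0"
  let ?I = "\<integral>\<^sup>+y\<in>{0..}. ennreal (exp (l * y)) \<partial>block_distr"
  have "ennreal (l\<^sup>2 * 2 ^ k) \<le> ?I" for k
  proof -
    have "(l * onset k)\<^sup>2 / 2 \<le> exp (l * onset k)"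
      using exp_lower_Taylor_quadratic[of "l * onset k"] mult_pos_pos[OF l onset_pos[of k]] by linarith
    moreover have "level k / 2 \<le> level k - level (Suc k)"
      using level_Suc_le_quarter[of k] level_pos[of k] by simp
    ultimately have "(l * onset k)\<^sup>2 / 2 * (level k / 2) \<le> exp (l * onset k) * (level k - level (Suc k))"
      using level_pos[of k] by (intro mult_mono) auto
    moreover have "(l * onset k)\<^sup>2 / 2 * (level k / 2) = l\<^sup>2 * (onset k * (1/2) ^ k)"
      using arg_cong[OF level_mult_onset[of k], of "\<lambda>t. l\<^sup>2 * onset k * t / 4"]
      by (simp add: power2_eq_square mult_ac)
    moreover have "l\<^sup>2 * 2 ^ k \<le> l\<^sup>2 * (onset k * (1/2) ^ k)"
    proof (intro mult_left_mono)
      have "2 * 4 ^ k * (1/2) ^ k \<le> onset k * (1/2) ^ k"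
        by (intro mult_right_mono onset_ge_4_power) auto
      moreover have "2 * 4 ^ k * (1/2) ^ k = 2 * (2::real) ^ k"
        by (simp add: power_mult_distrib[symmetric])
      moreover have "0 \<le> (2::real) ^ k" by simp
      ultimately show "2 ^ k \<le> onset k * (1/2) ^ k" by linarith
    qed auto
    ultimately have "ennreal (l\<^sup>2 * 2 ^ k) \<le> ennreal (exp (l * onset k) * (level k - level (Suc k)))"
      by (intro ennreal_leI) linarith
    also have "\<dots> = (\<integral>\<^sup>+y. ennreal (exp (l * onset k)) * indicator (block k) y \<partial>block_distr)"
      by (subst nn_integral_cmult_indicator) (auto simp: emeasure_block_distr_block ennreal_mult level_decseq)
    also have "\<dots> \<le> ?I"
      using l onset_pos[of k] by (intro nn_integral_mono) (auto simp: block_def indicator_def intro!: ennreal_leI)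
    finally show ?thesis .
  qed
  note ge = this
  show "?I = \<infinity>"
  proof (rule ccontr)
    assume "?I \<noteq> \<infinity>"
    then obtain r where r: "r \<ge> 0" "?I = ennreal r" by (cases ?I) auto
    obtain k where "r / l\<^sup>2 < 2 ^ k"
      using real_arch_pow[of 2 "r / l\<^sup>2"] by auto
    then have "r < l\<^sup>2 * 2 ^ k" using l by (simp add: field_simps)
    with ge[of k] r show False by (simp add: ennreal_le_iff)
  qed
qed

text \<open>The onsets grow by factors that outrun every \<open>n\<close>: if block \<open>k\<close>
  meets \<open>[x / n, x]\<close> and \<open>x\<close> is large, then \<open>x\<close> still lies
  before the next onset. Hence the tail at \<open>x\<close> is at least
  \<open>level (Suc k) / 2\<close>, half the density on block \<open>k\<close>.\<close>

lemma block_distr_in_class_J: "block_distr \<in> class_J"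
proof (rule class_J_if_local_density_bound[OF unbounded_nonneg_block_distr integrable_block_distr])
  fix n :: nat assume n: "n \<ge> 2"
  obtain k0 where k0: "3 * real n < 4 ^ k0"
    using real_arch_pow[of 4 "3 * real n"] by auto
  have "measure block_distr {a<..b} \<le> 2 * tail block_distr x * (b - a)"
    if x: "x > 3 * real n * onset k0" and ab: "x / real n \<le> a" "a \<le> b" "b \<le> x" for x a b
  proof -
    let ?t = "2 * tail block_distr x"
    have le: "level (Suc k) \<le> ?t" if ne: "{a<..b} \<inter> block k \<noteq> {}" for k
    proof -
      from ne obtain y where y: "a < y" "y \<le> b" "y \<in> block k" by auto
      have y3: "y \<le> 3 * onset k" using y(3) width_le_2_onset[of k] by (auto simp: block_def)
      have "x < n * y"
      proof -
        have "x / n < y" using ab(1) y(1) by linarith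
        then show ?thesis using n by (simp add: divide_less_eq mult.commute)
      qed
      also have "\<dots> \<le> n * (3 * onset k)" using y3 by (intro mult_left_mono) auto
      finally have xk: "x < 3 * n * onset k" by simp
      \<comment> \<open>Blocks before \<open>k0\<close> end too early to reach \<open>x / n\<close>.
        From \<open>k0\<close> on, \<open>3 * n\<close> is below the growth factor
        \<open>2 * 4 ^ k\<close> of the onsets.\<close>
      have "k0 \<le> k"
      proof (rule ccontr)
        assume "\<not> k0 \<le> k"
        then have "3 * real n * onset k \<le> 3 * real n * onset k0"
          by (intro mult_left_mono onset_mono) auto
        then show False using x xk by simp
      qed
      then have "(4::real) ^ k0 \<le> 4 ^ k" by (intro power_increasing) auto
      then have "3 * real n \<le> 2 * 4 ^ k" using k0 by linarith
      then have "3 * real n * onset k \<le> (2 * 4 ^ k) * onset k"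
        using onset_pos[of k] by (intro mult_right_mono) auto
      then have "x < onset (Suc k)" using xk by (simp add: onset_Suc)
      from tail_block_distr_ge[OF this] show ?thesis by simp
    qed
    have "ennreal (measure block_distr {a<..b}) = (\<Sum>k. ennreal (level (Suc k)) * emeasure lborel ({a<..b} \<inter> block k))"
      by (simp add: emeasure_block_distr flip: BD.emeasure_eq_measure)
    also have "\<dots> \<le> (\<Sum>k. ennreal ?t * emeasure lborel ({a<..b} \<inter> block k))"
    proof (intro suminf_le summableI)
      fix k
      show "ennreal (level (Suc k)) * emeasure lborel ({a<..b} \<inter> block k)
          \<le> ennreal ?t * emeasure lborel ({a<..b} \<inter> block k)"
        using le[of k] by (cases "{a<..b} \<inter> block k = {}") (auto intro!: mult_right_mono ennreal_leI)
    qed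
    also have "\<dots> = ennreal ?t * emeasure lborel (\<Union>k. {a<..b} \<inter> block k)"
      using disjoint_block
      by (subst suminf_emeasure[symmetric]) (auto simp: disjoint_family_on_def ennreal_suminf_cmult)
    also have "\<dots> \<le> ennreal ?t * emeasure lborel {a<..b}"
      by (intro mult_left_mono emeasure_mono) auto
    also have "\<dots> = ennreal (?t * (b - a))"
      using ab by (simp add: ennreal_mult BD.tail_nonneg)
    finally show ?thesis
      using ab BD.tail_nonneg[of x] by (subst (asm) ennreal_le_iff) auto
  qed
  then show "\<exists>C\<ge>0. \<exists>x0. \<forall>x\<ge>x0. \<forall>a b. x / real n \<le> a \<longrightarrow> a \<le> b \<longrightarrow> b \<le> x \<longrightarrow>
      measure block_distr {a<..b} \<le> C * tail block_distr x * (b - a)"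
    by (intro exI[of _ 2] conjI exI[of _ "3 * real n * onset k0 + 1"]) auto
qed

text \<open>For \<open>y\<close> strictly between \<open>onset k / 2\<close> and
  \<open>onset k\<close>, both \<open>y\<close> and \<open>x - y\<close> lie before block
  \<open>k\<close>, so both tails are at least \<open>level k / 2\<close>. The point
  \<open>x\<close> lies past the block, where the tail is at most
  \<open>level (Suc k)\<close>.\<close>

lemma block_distr_convolution_ge:
  assumes k: "k \<ge> 3"
  defines "x \<equiv> 3/2 * onset k"
  shows "2 ^ Suc k \<le> 1 / tail block_distr x * (LBINT y:{0..x}. tail block_distr (x - y) * tail block_distr y)"
proof -
  let ?z = "onset k" and ?f = "\<lambda>y. tail block_distr (x - y) * tail block_distr y"
  have z: "?z > 0" by (rule onset_pos)
  have pos: "tail block_distr x > 0"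
    using unbounded_nonneg_block_distr by (simp add: unbounded_nonneg_distribution_def)
  have tail: "tail block_distr x \<le> level (Suc k)"
    using width_le_half_onset[OF k] by (intro tail_block_distr_le) (simp add: x_def)
  have int: "set_integrable lborel {0..x} ?f"
    unfolding set_integrable_def
    by (rule integrableI_bounded_set_indicator[where B=1])
       (use z in \<open>auto simp: x_def BD.tail_nonneg BD.tail_le_1 abs_mult intro!: mult_le_one\<close>)
  have "(level k / 2)\<^sup>2 * (?z / 2) = (LBINT y:{?z/2<..<?z}. (level k / 2)\<^sup>2)"
    using z by (simp add: set_lebesgue_integral_def)
  also have "\<dots> \<le> (LBINT y:{0..x}. ?f y)"
    unfolding set_lebesgue_integral_def
  proof (rule integral_mono)
    fix y
    have "(level k / 2)\<^sup>2 \<le> ?f y" if "?z/2 < y" "y < ?z"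
      unfolding power2_eq_square using that level_pos[of k]
      by (intro mult_mono tail_block_distr_ge) (auto simp: x_def BD.tail_nonneg)
    then show "indicator {?z/2<..<?z} y *\<^sub>R (level k / 2)\<^sup>2 \<le> indicator {0..x} y *\<^sub>R ?f y"
      using z by (auto simp: indicator_def x_def BD.tail_nonneg)
  qed (use int z in \<open>auto simp: set_integrable_def\<close>)
  finally have I: "(level k / 2)\<^sup>2 * (?z / 2) \<le> (LBINT y:{0..x}. ?f y)" .
  have "(level k / 2)\<^sup>2 * (?z / 2) = level k * (level k * onset k) / 8"
    by (simp add: power2_eq_square)
  also have "\<dots> = level k * (1/2) ^ k / 2" unfolding level_mult_onset by simp
  \<comment> \<open>The drop of the tail over the block gains \<open>4 ^ Suc k\<close>, which
    outweighs the loss \<open>(1/2) ^ k\<close> from \<open>level k * onset k\<close>.\<close>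
  also have "\<dots> = level (Suc k) * (4 ^ Suc k * (1/2) ^ k) / 2"
    by (subst level_Suc) simp
  also have "(4::real) ^ Suc k * (1/2) ^ k = 4 * 2 ^ k"
    by (simp add: power_mult_distrib[symmetric])
  finally have "2 ^ Suc k * level (Suc k) \<le> (LBINT y:{0..x}. ?f y)"
    using I by (simp add: mult_ac)
  moreover have "2 ^ Suc k * tail block_distr x \<le> 2 ^ Suc k * level (Suc k)"
    using tail by (intro mult_left_mono) auto
  ultimately have "2 ^ Suc k * tail block_distr x \<le> (LBINT y:{0..x}. ?f y)"
    by linarith
  then show ?thesis using pos by (simp add: field_simps)
qed

lemma block_distr_not_in_class_OS_star: "block_distr \<notin> class_OS_star"
proof
  let ?r = "\<lambda>x. 1 / tail block_distr x * (LBINT y:{0..x}. tail block_distr (x - y) * tail block_distr y)"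
  assume "block_distr \<in> class_OS_star"
  then have "Limsup at_top (\<lambda>x. ereal (?r x)) < \<infinity>" by (simp add: class_OS_star_def)
  then obtain B where "Limsup at_top (\<lambda>x. ereal (?r x)) < ereal B"
    using ereal_dense2 by blast
  then have "\<forall>\<^sub>F x in at_top. ereal (?r x) < ereal B" by (rule Limsup_lessD)
  moreover have "filterlim (\<lambda>k. 3/2 * onset k) at_top sequentially"
    by (rule filterlim_tendsto_pos_mult_at_top[OF tendsto_const _ onset_at_top]) simp
  ultimately have "\<forall>\<^sub>F k in sequentially. ereal (?r (3/2 * onset k)) < ereal B"
    by (auto simp: filterlim_iff)
  moreover have "\<forall>\<^sub>F k in sequentially. B \<le> 2 ^ Suc k"
  proof -
    obtain N where "B < 2 ^ N" using real_arch_pow[of 2 B] by auto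
    have "B \<le> 2 ^ Suc k" if "N \<le> k" for k
    proof -
      have "(2::real) ^ N \<le> 2 ^ Suc k"
        using that by (intro power_increasing) auto
      then show ?thesis using \<open>B < 2 ^ N\<close> by linarith
    qed
    then show ?thesis by (auto simp: eventually_sequentially)
  qed
  ultimately have "\<forall>\<^sub>F k in sequentially. False"
    using eventually_ge_at_top[of 3]
  proof eventually_elim
    case (elim k)
    with block_distr_convolution_ge[of k] show False by simp
  qed
  then show False by simp
qed

theorem proposition1p1:
  fixes \<gamma> :: real
  assumes "\<gamma> > 0"
  shows "(\<forall>F \<in> (class_Jf \<inter> class_K) - class_OS_star. exp_tilt \<gamma> F \<notin> class_J) \<and>
         (class_Jf \<inter> class_K) - class_OS_star \<noteq> {}"
proof
  show "\<forall>F \<in> (class_Jf \<inter> class_K) - class_OS_star. exp_tilt \<gamma> F \<notin> class_J"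
    using class_OS_star_if_exp_tilt_in_class_J[OF assms]
    by (auto simp: class_Jf_def class_J_def)
  have "block_distr \<in> (class_Jf \<inter> class_K) - class_OS_star"
    by (simp add: class_Jf_def block_distr_in_class_J block_distr_in_class_K
        integrable_block_distr block_distr_not_in_class_OS_star)
  then show "(class_Jf \<inter> class_K) - class_OS_star \<noteq> {}" by blast
qed

end
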